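(* Let $g\in\mathcal{B}$ be a non-constant function. For each $\gamma>0$, both $[V_g,A^{-\gamma}]$ and $[V_g,A^{-\gamma}_0]$ are Banach spaces (for their norms $f\mapsto\|V_gf\|_{-\gamma}$).
   Context: $\mathbb{D}$ is the open unit disc in $\mathbb{C}$ and $H(\mathbb{D})$ is the space of analytic functions on $\mathbb{D}$. For $\gamma>0$, $A^{-\gamma}:=\{f\in H(\mathbb{D}): \|f\|_{-\gamma}:=\sup_{z\in\mathbb{D}}(1-|z|)^\gamma|f(z)|<\infty\}$ and $A^{-\gamma}_0:=\{f\in H(\mathbb{D}): \lim_{|z|\to1^-}(1-|z|)^\gamma|f(z)|=0\}$, both Banach spaces with norm $\|\cdot\|_{-\gamma}$. The Bloch space is $\mathcal{B}:=\{g\in H(\mathbb{D}): \sup_{z\in\mathbb{D}}(1-|z|)|g'(z)|<\infty\}$. The Volterra operator is $(V_gf)(z):=\int_0^zf(\xi)g'(\xi)\,d\xi$ for $f\in H(\mathbb{D})$, $z\in\mathbb{D}$. For $g\in\mathcal{B}$ it is known that $V_g$ maps $A^{-\gamma}$ continuously into $A^{-\gamma}$ and $A^{-\gamma}_0$ continuously into $A^{-\gamma}_0$. The optimal domains are $[V_g,A^{-\gamma}]:=\{f\in H(\mathbb{D}): V_gf\in A^{-\gamma}\}$ and $[V_g,A^{-\gamma}_0]:=\{f\in H(\mathbb{D}): V_gf\in A^{-\gamma}_0\}$, each endowed with $f\mapsto\|V_gf\|_{-\gamma}$. *)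

theory Defs
  imports "HOL-Complex_Analysis.Complex_Analysis" "HOL-Library.Function_Algebras"
begin

text \<open>
  Normed and Banach spaces over the complex numbers, carried by a linear subspace \<open>E\<close> of an
  ambient vector space. Nothing is required of \<open>N\<close> outside \<open>E\<close>, whereas the library's
  \<^locale>\<open>Metric_space\<close> asks for a distance that is nonnegative and symmetric everywhere; hence
  the value 0 off \<open>E\<close> in the distance below.
\<close>

locale complex_normed_space = vector_space scale
  for scale :: "complex \<Rightarrow> 'a::ab_group_add \<Rightarrow> 'a" +
  fixes E :: "'a set" and N :: "'a \<Rightarrow> real"
  assumes subspace_carrier: "subspace E"
    and norm_nonneg: "x \<in> E \<Longrightarrow> 0 \<le> N x"
    and norm_eq_zero: "x \<in> E \<Longrightarrow> N x = 0 \<longleftrightarrow> x = 0"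
    and norm_scale: "x \<in> E \<Longrightarrow> N (scale c x) = cmod c * N x"
    and norm_triangle: "x \<in> E \<Longrightarrow> y \<in> E \<Longrightarrow> N (x + y) \<le> N x + N y"
begin

definition norm_dist :: "'a \<Rightarrow> 'a \<Rightarrow> real" where
  "norm_dist x y = (if x \<in> E \<and> y \<in> E then N (x - y) else 0)"

lemma norm_minus_commute: "x \<in> E \<Longrightarrow> y \<in> E \<Longrightarrow> N (x - y) = N (y - x)"
  using norm_scale[of "x - y" "-1"] subspace_diff[OF subspace_carrier] by simp

lemma norm_diff_triangle:
  "x \<in> E \<Longrightarrow> y \<in> E \<Longrightarrow> z \<in> E \<Longrightarrow> N (x - z) \<le> N (x - y) + N (y - z)"
  using norm_triangle[of "x - y" "y - z"] subspace_diff[OF subspace_carrier] by simp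

sublocale Metric_space E norm_dist
proof
  show "0 \<le> norm_dist x y" for x y
    by (simp add: norm_dist_def norm_nonneg subspace_diff[OF subspace_carrier])
  show "norm_dist x y = norm_dist y x" for x y
    by (simp add: norm_dist_def norm_minus_commute)
  show "norm_dist x y = 0 \<longleftrightarrow> x = y" if "x \<in> E" "y \<in> E" for x y
    using that by (simp add: norm_dist_def norm_eq_zero subspace_diff[OF subspace_carrier])
  show "norm_dist x z \<le> norm_dist x y + norm_dist y z" if "x \<in> E" "y \<in> E" "z \<in> E" for x y z
    using that by (simp add: norm_dist_def norm_diff_triangle)
qed

end

locale complex_banach_space = complex_normed_space scale E N
  for scale :: "complex \<Rightarrow> 'a::ab_group_add \<Rightarrow> 'a" and E :: "'a set" and N :: "'a \<Rightarrow> real" +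
  assumes complete: mcomplete

text \<open>
  Addition of functions is pointwise, from the type class instances of
  \<^theory>\<open>HOL-Library.Function_Algebras\<close>.
\<close>

definition fun_scale :: "complex \<Rightarrow> (complex \<Rightarrow> complex) \<Rightarrow> complex \<Rightarrow> complex" where
  "fun_scale c f = (\<lambda>z. c * f z)"

abbreviation unit_disc :: "complex set" where
  "unit_disc \<equiv> ball 0 1"

text \<open>
  A function on the disc is represented by its extension by 0 to the whole plane, so that
  equality in \<open>H_disc\<close> is equality on the disc.
\<close>

definition H_disc :: "(complex \<Rightarrow> complex) set" where
  "H_disc = {f. f holomorphic_on unit_disc \<and> (\<forall>z. z \<notin> unit_disc \<longrightarrow> f z = 0)}"

definition growth_norm :: "real \<Rightarrow> (complex \<Rightarrow> complex) \<Rightarrow> real" where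
  "growth_norm \<gamma> f = (SUP z\<in>unit_disc. (1 - cmod z) powr \<gamma> * cmod (f z))"

text \<open>
  Finiteness of the supremum is expressed by \<^const>\<open>bdd_above\<close>, as the real-valued
  \<^const>\<open>growth_norm\<close> is unspecified for unbounded sets.
\<close>

definition growth_space :: "real \<Rightarrow> (complex \<Rightarrow> complex) set" where
  "growth_space \<gamma> =
     {f \<in> H_disc. bdd_above ((\<lambda>z. (1 - cmod z) powr \<gamma> * cmod (f z)) ` unit_disc)}"

definition little_growth_space :: "real \<Rightarrow> (complex \<Rightarrow> complex) set" where
  "little_growth_space \<gamma> =
     {f \<in> H_disc.
        ((\<lambda>z. (1 - cmod z) powr \<gamma> * cmod (f z)) \<longlongrightarrow> 0) (filtercomap cmod (at_left 1))}"

definition bloch_space :: "(complex \<Rightarrow> complex) set" where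
  "bloch_space =
     {g \<in> H_disc. bdd_above ((\<lambda>z. (1 - cmod z) * cmod (deriv g z)) ` unit_disc)}"

definition volterra :: "(complex \<Rightarrow> complex) \<Rightarrow> (complex \<Rightarrow> complex) \<Rightarrow> complex \<Rightarrow> complex" where
  "volterra g f =
     (\<lambda>z. if z \<in> unit_disc then contour_integral (linepath 0 z) (\<lambda>\<xi>. f \<xi> * deriv g \<xi>) else 0)"

definition optimal_domain ::
    "(complex \<Rightarrow> complex) \<Rightarrow> (complex \<Rightarrow> complex) set \<Rightarrow> (complex \<Rightarrow> complex) set" where
  "optimal_domain g X = {f \<in> H_disc. volterra g f \<in> X}"

end

theory Submission
  imports Defs
begin

text \<open>
  The point is that the norm \<open>\<parallel>V\<^sub>g f\<parallel>\<close> controls \<open>f\<close> uniformly on every disc \<open>\<bar>z\<bar> \<le> r < 1\<close>, in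
  spite of the zeros of \<open>g'\<close>: only finitely many of these lie in a smaller disc, so \<open>g'\<close> does not
  vanish on some circle \<open>\<bar>z\<bar> = \<rho>\<close> with \<open>r < \<rho> < 1\<close>; on that circle \<open>f = (V\<^sub>g f)' / g'\<close> is bounded
  by a multiple of \<open>\<parallel>V\<^sub>g f\<parallel>\<close> by Cauchy's estimate, and the maximum principle carries the bound
  inside. Hence the norm is definite, and a Cauchy sequence converges locally uniformly to an
  analytic \<open>f\<close>; then \<open>V\<^sub>g f\<^sub>n \<rightarrow> V\<^sub>g f\<close> pointwise, and the weighted supremum estimates pass to the
  limit.
\<close>

section \<open>Analytic functions on the disc: linear structure, locally uniform limits,
  zeros\<close>

lemma H_disc_0: "0 \<in> H_disc"
  by (auto simp: H_disc_def zero_fun_def)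

lemma H_disc_add: "f \<in> H_disc \<Longrightarrow> h \<in> H_disc \<Longrightarrow> f + h \<in> H_disc"
  by (auto simp: H_disc_def plus_fun_def intro!: holomorphic_intros)

lemma H_disc_scale: "f \<in> H_disc \<Longrightarrow> fun_scale c f \<in> H_disc"
  by (auto simp: H_disc_def fun_scale_def intro!: holomorphic_intros)

lemma vector_space_fun_scale: "vector_space fun_scale"
  by standard (auto simp: fun_scale_def fun_eq_iff algebra_simps)

text \<open>Weierstrass' theorem for locally uniform limits, applied to the pointwise limit. That
  limit also respects the convention of \<open>H_disc\<close>: off the disc every \<open>f n\<close>
  is 0, so the limit is 0 there.\<close>

lemma H_disc_uniform_limit:
  assumes f: "\<And>n. f n \<in> H_disc"
    and cauchy: "\<And>r. r < 1 \<Longrightarrow> uniformly_Cauchy_on (cball 0 r) f"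
  obtains l where "l \<in> H_disc" "\<And>r. r < 1 \<Longrightarrow> uniform_limit (cball 0 r) f l sequentially"
proof
  let ?l = "\<lambda>z. lim (\<lambda>n. f n z)"
  show ul: "uniform_limit (cball 0 r) f ?l sequentially" if "r < 1" for r
    using Cauchy_uniformly_convergent[OF cauchy[OF that]]
    by (simp add: uniformly_convergent_uniform_limit_iff)
  have "?l holomorphic_on unit_disc"
  proof (rule holomorphic_uniform_sequence)
    show "open unit_disc" by simp
    show "f n holomorphic_on unit_disc" for n
      using f by (simp add: H_disc_def)
    show "\<exists>d>0. cball z d \<subseteq> unit_disc \<and> uniform_limit (cball z d) f ?l sequentially"
      if z: "z \<in> unit_disc" for z
    proof -
      \<comment> \<open>Half the distance from \<open>z\<close> to the unit circle: the closed disc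
        about \<open>z\<close> then lies in a concentric closed disc of radius below 1, where
        uniform convergence is available.\<close>
      define d where "d = (1 - cmod z) / 2"
      have d: "d > 0" "cmod z + d < 1"
        using z by (auto simp: d_def field_simps)
      have sub: "cball z d \<subseteq> cball 0 (cmod z + d)"
        by (simp add: cball_subset_cball_iff)
      moreover have "cball 0 (cmod z + d) \<subseteq> unit_disc"
        using d by (simp add: cball_subset_ball_iff)
      ultimately show ?thesis
        using d uniform_limit_on_subset[OF ul sub] by blast
    qed
  qed
  moreover have "?l z = 0" if "z \<notin> unit_disc" for z
    using f that by (simp add: H_disc_def)
  ultimately show "?l \<in> H_disc"
    by (simp add: H_disc_def)
qed

text \<open>A compact smaller disc contains only finitely many zeros of \<open>q\<close>, hence
  their moduli miss some radius in the interval from \<open>r\<close> to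
  \<open>(r + 1) / 2\<close>.\<close>

lemma holomorphic_nonzero_circle:
  assumes hol: "q holomorphic_on unit_disc" and nz: "\<exists>z\<in>unit_disc. q z \<noteq> 0" and "r < 1"
  obtains \<rho> where "r < \<rho>" "\<rho> < 1" "\<And>z. cmod z = \<rho> \<Longrightarrow> q z \<noteq> 0"
proof -
  let ?Z = "{z \<in> cball 0 ((r + 1) / 2). q z = 0}"
  have K: "cball 0 ((r + 1) / 2) \<subseteq> unit_disc"
    using \<open>r < 1\<close> by (simp add: cball_subset_ball_iff)
  have "finite ?Z"
  proof (cases "q constant_on unit_disc")
    \<comment> \<open>A constant \<open>q\<close> is a nonzero constant by \<open>nz\<close>; the
      identity theorem is needed only in the other case.\<close>
    case True
    then have "?Z = {}"
      using nz K by (auto simp: constant_on_def subset_iff)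
    then show ?thesis by (metis finite.emptyI)
  next
    case False
    then show ?thesis
      using holomorphic_compact_finite_zeros[OF hol _ _ _ K] by simp
  qed
  moreover have "infinite {r<..<(r + 1) / 2}"
    using \<open>r < 1\<close> by (intro infinite_Ioo) simp
  ultimately have "\<not> {r<..<(r + 1) / 2} \<subseteq> cmod ` ?Z"
    by (meson finite_imageI finite_subset)
  then obtain \<rho> where \<rho>: "\<rho> \<in> {r<..<(r + 1) / 2}" "\<rho> \<notin> cmod ` ?Z"
    by blast
  show thesis
  proof
    show "r < \<rho>" "\<rho> < 1" using \<rho> \<open>r < 1\<close> by auto
    show "q z \<noteq> 0" if "cmod z = \<rho>" for z
      using \<rho> that by auto
  qed
qed

text \<open>Vanishing derivative on a connected open set forces constancy. This makes
  \<open>holomorphic_nonzero_circle\<close> applicable to \<open>deriv g\<close>.\<close>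

lemma holomorphic_deriv_nonzero:
  assumes "g holomorphic_on unit_disc" "\<not> g constant_on unit_disc"
  shows "\<exists>z\<in>unit_disc. deriv g z \<noteq> 0"
proof (rule ccontr)
  assume "\<not> ?thesis"
  then have "(g has_field_derivative 0) (at z)" if "z \<in> unit_disc" for z
    using that holomorphic_derivI[OF assms(1) open_ball that] by simp
  then have "g constant_on unit_disc"
    by (intro has_field_derivative_0_imp_constant_on) auto
  with assms show False by blast
qed

section \<open>Growth spaces\<close>

lemma growth_spaceI:
  assumes "u \<in> H_disc" "\<And>z. z \<in> unit_disc \<Longrightarrow> (1 - cmod z) powr \<gamma> * cmod (u z) \<le> B"
  shows "u \<in> growth_space \<gamma>"
  using assms by (auto simp: growth_space_def intro!: bdd_aboveI2)

lemma growth_norm_upper: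
  assumes "u \<in> growth_space \<gamma>" "z \<in> unit_disc"
  shows "(1 - cmod z) powr \<gamma> * cmod (u z) \<le> growth_norm \<gamma> u"
  using assms unfolding growth_space_def growth_norm_def by (intro cSUP_upper) auto

lemma growth_norm_least:
  assumes "\<And>z. z \<in> unit_disc \<Longrightarrow> (1 - cmod z) powr \<gamma> * cmod (u z) \<le> B"
  shows "growth_norm \<gamma> u \<le> B"
  using assms unfolding growth_norm_def by (intro cSUP_least) auto

lemma growth_norm_nonneg: "u \<in> growth_space \<gamma> \<Longrightarrow> 0 \<le> growth_norm \<gamma> u"
  using growth_norm_upper[of u \<gamma> 0] by (simp add: order_trans[OF norm_ge_zero])

lemma growth_norm_0: "growth_norm \<gamma> 0 = 0"
  unfolding growth_norm_def by simp

text \<open>Kept pointwise because it yields two facts: boundedness, hence membership of the sum,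
  and the triangle inequality after taking the supremum.\<close>

lemma weighted_add_le:
  assumes "u \<in> growth_space \<gamma>" "v \<in> growth_space \<gamma>" "z \<in> unit_disc"
  shows "(1 - cmod z) powr \<gamma> * cmod ((u + v) z) \<le> growth_norm \<gamma> u + growth_norm \<gamma> v"
proof -
  have "(1 - cmod z) powr \<gamma> * cmod ((u + v) z)
      \<le> (1 - cmod z) powr \<gamma> * (cmod (u z) + cmod (v z))"
    by (simp add: mult_left_mono norm_triangle_ineq)
  then show ?thesis
    using growth_norm_upper[OF assms(1,3)] growth_norm_upper[OF assms(2,3)]
    by (simp add: distrib_left)
qed

lemma growth_norm_add:
  "u \<in> growth_space \<gamma> \<Longrightarrow> v \<in> growth_space \<gamma> \<Longrightarrow>
    growth_norm \<gamma> (u + v) \<le> growth_norm \<gamma> u + growth_norm \<gamma> v"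
  by (intro growth_norm_least weighted_add_le)

lemma weighted_scale_le:
  assumes "u \<in> growth_space \<gamma>" "z \<in> unit_disc"
  shows "(1 - cmod z) powr \<gamma> * cmod (fun_scale c u z) \<le> cmod c * growth_norm \<gamma> u"
  using mult_left_mono[OF growth_norm_upper[OF assms], of "cmod c"]
  by (simp add: fun_scale_def norm_mult mult.left_commute)

lemma growth_space_add:
  "u \<in> growth_space \<gamma> \<Longrightarrow> v \<in> growth_space \<gamma> \<Longrightarrow> u + v \<in> growth_space \<gamma>"
  by (rule growth_spaceI[OF H_disc_add weighted_add_le]) (auto simp: growth_space_def)

lemma growth_space_scale: "u \<in> growth_space \<gamma> \<Longrightarrow> fun_scale c u \<in> growth_space \<gamma>"
  by (rule growth_spaceI[OF H_disc_scale weighted_scale_le]) (auto simp: growth_space_def)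

lemma growth_norm_scale:
  assumes u: "u \<in> growth_space \<gamma>"
  shows "growth_norm \<gamma> (fun_scale c u) = cmod c * growth_norm \<gamma> u"
proof (cases "c = 0")
  case True
  then have "fun_scale c u = 0" by (auto simp: fun_scale_def fun_eq_iff)
  then show ?thesis using True by (simp add: growth_norm_0)
next
  case False
  \<comment> \<open>The pointwise estimate gives only the upper bound for the norm of a multiple;
    the lower bound comes from scaling back by \<open>inverse c\<close>.\<close>
  have "growth_norm \<gamma> u = growth_norm \<gamma> (fun_scale (inverse c) (fun_scale c u))"
    using False by (simp add: fun_scale_def mult.assoc[symmetric])
  also have "\<dots> \<le> cmod (inverse c) * growth_norm \<gamma> (fun_scale c u)"
    by (intro growth_norm_least weighted_scale_le growth_space_scale u)
  finally have "cmod c * growth_norm \<gamma> u \<le> growth_norm \<gamma> (fun_scale c u)"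
    using False by (simp add: norm_divide field_simps)
  moreover have "growth_norm \<gamma> (fun_scale c u) \<le> cmod c * growth_norm \<gamma> u"
    by (intro growth_norm_least weighted_scale_le u)
  ultimately show ?thesis by simp
qed

lemma subspace_growth_space: "module.subspace fun_scale (growth_space \<gamma>)"
proof -
  interpret vector_space fun_scale by (rule vector_space_fun_scale)
  have "0 \<in> growth_space \<gamma>"
    by (rule growth_spaceI[where B = 0]) (auto simp: H_disc_0)
  then show ?thesis
    by (intro subspaceI growth_space_add growth_space_scale)
qed

text \<open>One approximant at finite weighted distance \<open>e\<close> already bounds
  \<open>u\<close>, by the triangle inequality; \<open>e\<close> need not be small.\<close>

lemma growth_space_closed:
  assumes "h \<in> growth_space \<gamma>" "u \<in> H_disc"
    and close: "\<And>z. z \<in> unit_disc \<Longrightarrow> (1 - cmod z) powr \<gamma> * cmod (h z - u z) \<le> e"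
  shows "u \<in> growth_space \<gamma>"
proof (rule growth_spaceI)
  fix z :: complex assume z: "z \<in> unit_disc"
  have "(1 - cmod z) powr \<gamma> * cmod (u z)
      \<le> (1 - cmod z) powr \<gamma> * (cmod (h z) + cmod (h z - u z))"
    by (intro mult_left_mono norm_triangle_sub[of "u z" "h z", unfolded norm_minus_commute[of "u z"]]) simp
  then show "(1 - cmod z) powr \<gamma> * cmod (u z) \<le> growth_norm \<gamma> h + e"
    using growth_norm_upper[OF assms(1) z] close[OF z] by (simp add: distrib_left)
qed fact

section \<open>The little growth space\<close>

lemma little_growth_space_iff:
  "u \<in> little_growth_space \<gamma> \<longleftrightarrow> u \<in> H_disc \<and>
    (\<forall>e>0. \<exists>r<1. \<forall>z. r < cmod z \<and> cmod z < 1 \<longrightarrow> (1 - cmod z) powr \<gamma> * cmod (u z) < e)"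
proof -
  have ev: "eventually P (filtercomap cmod (at_left 1)) \<longleftrightarrow>
      (\<exists>r<1. \<forall>z. r < cmod z \<and> cmod z < 1 \<longrightarrow> P z)" for P
    unfolding eventually_filtercomap eventually_at_left_field
  proof safe
    fix r :: real assume r: "r < 1" "\<forall>z. r < cmod z \<and> cmod z < 1 \<longrightarrow> P z"
    \<comment> \<open>The witness must include \<open>t < 1\<close>, since nothing is known about
      \<open>P\<close> at points of modulus at least 1.\<close>
    show "\<exists>Q. (\<exists>b<1. \<forall>y>b. y < 1 \<longrightarrow> Q y) \<and> (\<forall>x. Q (cmod x) \<longrightarrow> P x)"
      using r by (intro exI[of _ "\<lambda>t. r < t \<and> t < 1"]) auto
  qed blast
  show ?thesis
    by (simp add: little_growth_space_def tendsto_iff ev abs_mult)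
qed

text \<open>Near the boundary the weighted modulus is below 1; on the remaining compact disc
  \<open>u\<close> is bounded by continuity, and the weight is at most 1 because
  \<open>\<gamma> \<ge> 0\<close>.\<close>

lemma little_growth_space_subset:
  assumes "\<gamma> \<ge> 0"
  shows "little_growth_space \<gamma> \<subseteq> growth_space \<gamma>"
proof
  fix u assume u: "u \<in> little_growth_space \<gamma>"
  then obtain r where r: "r < 1"
      "\<And>z. r < cmod z \<Longrightarrow> cmod z < 1 \<Longrightarrow> (1 - cmod z) powr \<gamma> * cmod (u z) < 1"
    unfolding little_growth_space_iff by (metis zero_less_one)
  have uH: "u \<in> H_disc" using u by (simp add: little_growth_space_iff)
  have "cball 0 r \<subseteq> unit_disc" using r by auto
  moreover have "u holomorphic_on unit_disc"
    using uH by (simp add: H_disc_def)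
  ultimately have "continuous_on (cball 0 r) u"
    using holomorphic_on_imp_continuous_on holomorphic_on_subset by blast
  then have "bounded (u ` cball 0 r)"
    by (intro compact_imp_bounded compact_continuous_image) auto
  then obtain B where B: "\<forall>w\<in>u ` cball 0 r. cmod w \<le> B"
    unfolding bounded_iff ..
  show "u \<in> growth_space \<gamma>"
  proof (rule growth_spaceI[OF uH])
    fix z :: complex assume z: "z \<in> unit_disc"
    show "(1 - cmod z) powr \<gamma> * cmod (u z) \<le> max 1 B"
    proof (cases "cmod z \<le> r")
      case True
      have "(1 - cmod z) powr \<gamma> \<le> 1"
        using powr_le1[OF assms, of "1 - cmod z"] z by simp
      then have "(1 - cmod z) powr \<gamma> * cmod (u z) \<le> cmod (u z)"
        by (simp add: mult_left_le_one_le)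
      moreover have "cmod (u z) \<le> B" using B True by simp
      ultimately show ?thesis by simp
    next
      case False
      then show ?thesis using r(2)[of z] z by simp
    qed
  qed
qed

lemma subspace_little_growth_space: "module.subspace fun_scale (little_growth_space \<gamma>)"
proof -
  interpret vector_space fun_scale by (rule vector_space_fun_scale)
  let ?w = "\<lambda>z. (1 - cmod z) powr \<gamma>" and ?F = "filtercomap cmod (at_left (1::real))"
  show ?thesis
  proof (rule subspaceI)
    show "0 \<in> little_growth_space \<gamma>"
      by (simp add: little_growth_space_def H_disc_0)
  next
    fix u v assume u: "u \<in> little_growth_space \<gamma>" and v: "v \<in> little_growth_space \<gamma>"
    have "((\<lambda>z. ?w z * cmod (u z) + ?w z * cmod (v z)) \<longlongrightarrow> 0 + 0) ?F"
      using u v unfolding little_growth_space_def by (intro tendsto_add) auto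
    then have "((\<lambda>z. ?w z * cmod ((u + v) z)) \<longlongrightarrow> 0) ?F"
      by (intro tendsto_sandwich[OF _ _ tendsto_const[of 0]
            \<open>((\<lambda>z. ?w z * cmod (u z) + ?w z * cmod (v z)) \<longlongrightarrow> 0 + 0) ?F\<close>[simplified]])
         (auto simp flip: distrib_left intro!: always_eventually mult_left_mono norm_triangle_ineq)
    then show "u + v \<in> little_growth_space \<gamma>"
      using u v by (simp add: little_growth_space_def H_disc_add)
  next
    fix c u assume u: "u \<in> little_growth_space \<gamma>"
    then have "((\<lambda>z. cmod c * (?w z * cmod (u z))) \<longlongrightarrow> 0) ?F"
      unfolding little_growth_space_def by (intro tendsto_mult_right_zero) auto
    then show "fun_scale c u \<in> little_growth_space \<gamma>"
      using u by (simp add: little_growth_space_def H_disc_scale)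
        (simp add: fun_scale_def norm_mult mult.left_commute)
  qed
qed

text \<open>An \<open>e / 2\<close> argument: half from the decay of an approximant near the
  boundary, half from its weighted distance to \<open>u\<close>. In contrast with
  \<open>growth_space_closed\<close>, arbitrarily good approximants are required.\<close>

lemma little_growth_space_closed:
  assumes u: "u \<in> H_disc"
    and approx: "\<And>e. e > 0 \<Longrightarrow>
      \<exists>h\<in>little_growth_space \<gamma>. \<forall>z\<in>unit_disc. (1 - cmod z) powr \<gamma> * cmod (h z - u z) \<le> e"
  shows "u \<in> little_growth_space \<gamma>"
  unfolding little_growth_space_iff
proof (intro conjI allI impI)
  fix e :: real assume "e > 0"
  then obtain h where h: "h \<in> little_growth_space \<gamma>"
    "\<And>z. z \<in> unit_disc \<Longrightarrow> (1 - cmod z) powr \<gamma> * cmod (h z - u z) \<le> e / 2"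
    using approx[of "e / 2"] by auto
  obtain r where r: "r < 1"
      "\<And>z. r < cmod z \<Longrightarrow> cmod z < 1 \<Longrightarrow> (1 - cmod z) powr \<gamma> * cmod (h z) < e / 2"
    using h(1) \<open>e > 0\<close> unfolding little_growth_space_iff by (metis half_gt_zero)
  show "\<exists>r<1. \<forall>z. r < cmod z \<and> cmod z < 1 \<longrightarrow> (1 - cmod z) powr \<gamma> * cmod (u z) < e"
  proof (intro exI conjI allI impI)
    fix z assume z: "r < cmod z \<and> cmod z < 1"
    have "(1 - cmod z) powr \<gamma> * cmod (u z)
        \<le> (1 - cmod z) powr \<gamma> * (cmod (h z) + cmod (h z - u z))"
      by (intro mult_left_mono norm_triangle_sub[of "u z" "h z", unfolded norm_minus_commute[of "u z"]]) simp
    then show "(1 - cmod z) powr \<gamma> * cmod (u z) < e"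
      using r(2)[of z] h(2)[of z] z by (simp add: distrib_left)
  qed (fact r)
qed (fact u)

text \<open>Cauchy's estimate on discs of a fixed radius centred on the circle of radius
  \<open>\<rho>\<close>. These discs stay away from the unit circle, so the weight is bounded below
  on them and \<open>C\<close> is independent of \<open>u\<close>.\<close>

lemma growth_deriv_bound:
  assumes "\<gamma> \<ge> 0" "0 \<le> \<rho>" "\<rho> < 1"
  obtains C where "C \<ge> 0"
    "\<And>u z. u \<in> growth_space \<gamma> \<Longrightarrow> cmod z = \<rho> \<Longrightarrow> cmod (deriv u z) \<le> C * growth_norm \<gamma> u"
proof
  \<comment> \<open>With half the gap as radius, the discs also keep distance at least
    \<open>s\<close> from the unit circle, so the weight on them is at least
    \<open>s powr \<gamma>\<close>.\<close>
  define s where "s = (1 - \<rho>) / 2"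
  have s: "s > 0" "\<rho> + s < 1" "1 - (\<rho> + s) = s"
    using assms by (auto simp: s_def field_simps)
  show "0 \<le> 1 / (s powr \<gamma> * s)"
    using s by simp
  fix u and z :: complex assume u: "u \<in> growth_space \<gamma>" and z: "cmod z = \<rho>"
  have in_disc: "w \<in> unit_disc" "s \<le> 1 - cmod w" if "w \<in> cball z s" for w
    using that norm_triangle_ineq2[of w z] z s by (auto simp: dist_norm norm_minus_commute)
  have hol: "u holomorphic_on unit_disc"
    using u by (simp add: growth_space_def H_disc_def)
  have sub: "cball z s \<subseteq> unit_disc" using in_disc by blast
  have "cmod ((deriv ^^ 1) u z) \<le> fact 1 * (growth_norm \<gamma> u / s powr \<gamma>) / s ^ 1"
  proof (rule Cauchy_inequality)
    show "u holomorphic_on ball z s"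
      using hol sub ball_subset_cball by (meson holomorphic_on_subset order_trans)
    show "continuous_on (cball z s) u"
      using hol sub by (meson holomorphic_on_subset holomorphic_on_imp_continuous_on)
    fix w assume "cmod (z - w) = s"
    then have w: "w \<in> cball z s" by (simp add: dist_norm)
    have "s powr \<gamma> * cmod (u w) \<le> (1 - cmod w) powr \<gamma> * cmod (u w)"
      using in_disc[OF w] s assms by (intro mult_right_mono powr_mono2) auto
    also have "\<dots> \<le> growth_norm \<gamma> u"
      using in_disc[OF w] by (intro growth_norm_upper u)
    finally show "cmod (u w) \<le> growth_norm \<gamma> u / s powr \<gamma>"
      using s by (simp add: field_simps)
  qed (use s in auto)
  then show "cmod (deriv u z) \<le> 1 / (s powr \<gamma> * s) * growth_norm \<gamma> u"
    by simp
qed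

section \<open>The Volterra operator\<close>

context
  fixes g assumes g: "g \<in> H_disc"
begin

lemma integrand_holomorphic:
  "f \<in> H_disc \<Longrightarrow> (\<lambda>\<xi>. f \<xi> * deriv g \<xi>) holomorphic_on unit_disc"
  using g by (auto simp: H_disc_def intro!: holomorphic_intros)

lemma segment_in_cball: "closed_segment 0 z \<subseteq> cball 0 (cmod z)" for z :: complex
  by (intro closed_segment_subset) auto

lemma integrand_integrable:
  assumes "f \<in> H_disc" "z \<in> unit_disc"
  shows "(\<lambda>\<xi>. f \<xi> * deriv g \<xi>) contour_integrable_on linepath 0 z"
proof (rule contour_integrable_holomorphic_simple[OF integrand_holomorphic[OF assms(1)]])
  show "path_image (linepath 0 z) \<subseteq> unit_disc"
    using assms(2) segment_in_cball[of z] by auto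
qed auto

text \<open>On the convex disc the integrand has a primitive \<open>F\<close>, and integration along
  the segment gives \<open>F w - F 0\<close>. This formula for the derivative is what allows
  \<open>f\<close> to be recovered from \<open>volterra g f\<close> wherever \<open>deriv g\<close>
  is nonzero.\<close>

lemma volterra_has_derivative:
  assumes f: "f \<in> H_disc" and z: "z \<in> unit_disc"
  shows "(volterra g f has_field_derivative f z * deriv g z) (at z)"
proof -
  obtain F where F: "\<And>z. z \<in> unit_disc \<Longrightarrow>
      (F has_field_derivative f z * deriv g z) (at z within unit_disc)"
    using holomorphic_convex_primitive'[OF convex_ball open_ball integrand_holomorphic[OF f]]
    by blast
  have "F w - F 0 = volterra g f w" if w: "w \<in> unit_disc" for w
  proof -
    have "path_image (linepath 0 w) \<subseteq> unit_disc"
      using w segment_in_cball[of w] by auto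
    from contour_integral_primitive[OF F _ this] show ?thesis
      using w by (simp add: volterra_def contour_integral_unique)
  qed
  moreover have "((\<lambda>w. F w - F 0) has_field_derivative f z * deriv g z) (at z)"
    using F[OF z] z by (auto intro!: derivative_eq_intros simp: at_within_open[OF _ open_ball])
  ultimately show ?thesis
    using has_field_derivative_transform_within_open[OF _ open_ball z] by blast
qed

lemma volterra_in_H_disc: "f \<in> H_disc \<Longrightarrow> volterra g f \<in> H_disc"
  using volterra_has_derivative[of f] unfolding H_disc_def
  by (auto simp: holomorphic_on_open) (blast, simp add: volterra_def)

section \<open>Linearity and sequential continuity of the Volterra operator\<close>

lemma volterra_add:
  "f \<in> H_disc \<Longrightarrow> h \<in> H_disc \<Longrightarrow> volterra g (f + h) = volterra g f + volterra g h"
  using integrand_integrable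
  by (auto simp: volterra_def fun_eq_iff distrib_right contour_integral_add)

lemma volterra_scale:
  "f \<in> H_disc \<Longrightarrow> volterra g (fun_scale c f) = fun_scale c (volterra g f)"
  using integrand_integrable
  by (auto simp: volterra_def fun_scale_def fun_eq_iff mult.assoc contour_integral_lmul)

lemma volterra_0: "volterra g 0 = 0"
  by (auto simp: volterra_def fun_eq_iff)

lemma volterra_diff:
  "f \<in> H_disc \<Longrightarrow> h \<in> H_disc \<Longrightarrow> volterra g (f - h) = volterra g f - volterra g h"
  using integrand_integrable
  by (auto simp: volterra_def fun_eq_iff left_diff_distrib contour_integral_diff)

text \<open>The segment from 0 to \<open>z\<close> lies in a closed disc inside the unit disc, on
  which the integrands converge uniformly, so the limit passes under the integral. Off the disc all
  values are 0.\<close>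

lemma volterra_tendsto:
  assumes f: "\<And>n. f n \<in> H_disc" and l: "l \<in> H_disc"
    and lim: "\<And>r. r < 1 \<Longrightarrow> uniform_limit (cball 0 r) f l sequentially"
  shows "(\<lambda>n. volterra g (f n) z) \<longlonglongrightarrow> volterra g l z"
proof (cases "z \<in> unit_disc")
  case True
  let ?K = "cball 0 (cmod z)"
  have K: "?K \<subseteq> unit_disc" using True by auto
  have bdd: "bounded (h ` ?K)" if "h holomorphic_on unit_disc" for h
    using that K
    by (meson compact_cball compact_continuous_image compact_imp_bounded
        holomorphic_on_imp_continuous_on holomorphic_on_subset)
  have "uniform_limit ?K (\<lambda>n \<xi>. f n \<xi> * deriv g \<xi>) (\<lambda>\<xi>. l \<xi> * deriv g \<xi>) sequentially"
    using True l g by (intro uniform_lim_mult lim uniform_limit_const bdd)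
      (auto simp: H_disc_def intro!: holomorphic_intros)
  moreover have "path_image (linepath 0 z) \<subseteq> ?K"
    using segment_in_cball[of z] by simp
  ultimately have "uniform_limit (path_image (linepath 0 z)) (\<lambda>n \<xi>. f n \<xi> * deriv g \<xi>)
      (\<lambda>\<xi>. l \<xi> * deriv g \<xi>) sequentially"
    by (rule uniform_limit_on_subset)
  \<comment> \<open>The bound \<open>B = cmod z\<close> below is the speed of the path, whose
    derivative is constantly \<open>z\<close>.\<close>
  then have "((\<lambda>n. contour_integral (linepath 0 z) (\<lambda>\<xi>. f n \<xi> * deriv g \<xi>))
      \<longlongrightarrow> contour_integral (linepath 0 z) (\<lambda>\<xi>. l \<xi> * deriv g \<xi>)) sequentially"
    using True f
    by (intro contour_integral_uniform_limit(2)[where B = "cmod z"] always_eventually allI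
          integrand_integrable) auto
  then show ?thesis using True by (simp add: volterra_def)
qed (simp add: volterra_def)

section \<open>Local uniform control by the norm, and completeness\<close>

lemma pointwise_bound:
  assumes "\<gamma> \<ge> 0" and nconst: "\<not> g constant_on unit_disc" and r: "0 \<le> r" "r < 1"
  obtains C where "C > 0"
    "\<forall>f\<in>optimal_domain g (growth_space \<gamma>). \<forall>z\<in>cball 0 r.
      cmod (f z) \<le> C * growth_norm \<gamma> (volterra g f)"
proof -
  have dg: "deriv g holomorphic_on unit_disc" and "\<exists>z\<in>unit_disc. deriv g z \<noteq> 0"
    using g nconst by (auto simp: H_disc_def intro!: holomorphic_intros holomorphic_deriv_nonzero)
  then obtain \<rho> where \<rho>: "r < \<rho>" "\<rho> < 1" "\<And>z. cmod z = \<rho> \<Longrightarrow> deriv g z \<noteq> 0"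
    using holomorphic_nonzero_circle[OF _ _ \<open>r < 1\<close>] by metis
  have sphere: "sphere 0 \<rho> \<subseteq> unit_disc" using \<rho> by auto
  \<comment> \<open>Compactness of the circle turns nonvanishing of \<open>deriv g\<close> into a
    bound \<open>M\<close> for its inverse.\<close>
  have "continuous_on (sphere 0 \<rho>) (\<lambda>z. inverse (deriv g z))"
    using \<rho> sphere dg
    by (intro continuous_on_inverse) (auto intro: holomorphic_on_imp_continuous_on holomorphic_on_subset)
  then have "bounded ((\<lambda>z. inverse (deriv g z)) ` sphere 0 \<rho>)"
    by (intro compact_imp_bounded compact_continuous_image) auto
  then obtain M where M: "M > 0" "\<And>z. cmod z = \<rho> \<Longrightarrow> cmod (inverse (deriv g z)) \<le> M"
    unfolding bounded_pos by auto
  obtain D where D: "D \<ge> 0"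
    "\<And>u z. u \<in> growth_space \<gamma> \<Longrightarrow> cmod z = \<rho> \<Longrightarrow> cmod (deriv u z) \<le> D * growth_norm \<gamma> u"
    using growth_deriv_bound[of \<gamma> \<rho>] assms \<rho> by auto
  show thesis
  proof (intro that ballI)
    \<comment> \<open>The summand 1 makes the constant positive even if \<open>D = 0\<close>; the
      completeness argument divides by it.\<close>
    show "D * M + 1 > 0" using D M by (simp add: add_nonneg_pos)
    fix f and z :: complex
    assume f: "f \<in> optimal_domain g (growth_space \<gamma>)" and z: "z \<in> cball 0 r"
    have fH: "f \<in> H_disc" and Vf: "volterra g f \<in> growth_space \<gamma>"
      using f by (auto simp: optimal_domain_def)
    have hol: "f holomorphic_on unit_disc" using fH by (simp add: H_disc_def)
    have cb: "cball 0 \<rho> \<subseteq> unit_disc" using \<rho> by auto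
    have "cmod (f z) \<le> D * M * growth_norm \<gamma> (volterra g f)"
    proof (rule maximum_modulus_frontier[of f "cball 0 \<rho>"])
      show "f holomorphic_on interior (cball 0 \<rho>)"
        using hol cb interior_subset by (meson holomorphic_on_subset order_trans)
      show "continuous_on (closure (cball 0 \<rho>)) f"
        using hol cb by (auto intro: holomorphic_on_imp_continuous_on holomorphic_on_subset)
      show "z \<in> cball 0 \<rho>" using z \<rho> by simp
      fix w :: complex assume "w \<in> frontier (cball 0 \<rho>)"
      then have w: "cmod w = \<rho>" by (simp add: frontier_cball)
      then have "deriv (volterra g f) w = f w * deriv g w"
        using \<rho> by (intro DERIV_imp_deriv volterra_has_derivative fH) auto
      then have "f w = deriv (volterra g f) w * inverse (deriv g w)"
        using \<rho>(3)[OF w] by simp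
      then have "cmod (f w) = cmod (deriv (volterra g f) w) * cmod (inverse (deriv g w))"
        by (simp only: norm_mult)
      also have "\<dots> \<le> (D * growth_norm \<gamma> (volterra g f)) * M"
        using D(1) by (intro mult_mono D(2) M(2) Vf w) (auto intro!: mult_nonneg_nonneg growth_norm_nonneg Vf)
      finally show "cmod (f w) \<le> D * M * growth_norm \<gamma> (volterra g f)"
        by (simp add: mult_ac)
    qed auto
    also have "\<dots> \<le> (D * M + 1) * growth_norm \<gamma> (volterra g f)"
      using growth_norm_nonneg[OF Vf] by (intro mult_right_mono) auto
    finally show "cmod (f z) \<le> (D * M + 1) * growth_norm \<gamma> (volterra g f)" .
  qed
qed

text \<open>Treats both optimal domains at once: \<open>X\<close> stands for either target space,
  and \<open>closed\<close> says that \<open>X\<close> contains its limits in the weighted uniform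
  sense.\<close>

lemma optimal_domain_banach:
  assumes "\<gamma> \<ge> 0" and nconst: "\<not> g constant_on unit_disc"
    and sub: "module.subspace fun_scale X" and X: "X \<subseteq> growth_space \<gamma>"
    and closed: "\<And>u. u \<in> H_disc \<Longrightarrow>
      (\<And>e. e > 0 \<Longrightarrow> \<exists>h\<in>X. \<forall>z\<in>unit_disc. (1 - cmod z) powr \<gamma> * cmod (h z - u z) \<le> e)
      \<Longrightarrow> u \<in> X"
  shows "complex_banach_space fun_scale (optimal_domain g X) (\<lambda>f. growth_norm \<gamma> (volterra g f))"
proof -
  let ?E = "optimal_domain g X" and ?N = "\<lambda>f. growth_norm \<gamma> (volterra g f)"
  interpret vector_space fun_scale by (rule vector_space_fun_scale)
  have EH: "f \<in> H_disc" and EV: "volterra g f \<in> growth_space \<gamma>"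
    and EX: "f \<in> optimal_domain g (growth_space \<gamma>)" if "f \<in> ?E" for f
    using that X by (auto simp: optimal_domain_def)
  have subE: "subspace ?E"
  proof (rule subspaceI)
    show "0 \<in> ?E"
      using subspace_0[OF sub] by (simp add: optimal_domain_def H_disc_0 volterra_0)
    show "f + h \<in> ?E" if "f \<in> ?E" "h \<in> ?E" for f h
      using that subspace_add[OF sub] by (simp add: optimal_domain_def H_disc_add volterra_add)
    show "fun_scale c f \<in> ?E" if "f \<in> ?E" for c f
      using that subspace_scale[OF sub] by (simp add: optimal_domain_def H_disc_scale volterra_scale)
  qed
  have normed: "complex_normed_space fun_scale ?E ?N"
  proof
    show "subspace ?E" by (fact subE)
    fix f assume f: "f \<in> ?E"
    show "0 \<le> ?N f" by (intro growth_norm_nonneg EV f)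
    show "?N (fun_scale c f) = cmod c * ?N f" for c
      by (simp add: volterra_scale EH EV f growth_norm_scale)
    show "?N f = 0 \<longleftrightarrow> f = 0"
    proof
      \<comment> \<open>Definiteness: inside the disc \<open>pointwise_bound\<close> gives
        \<open>f z = 0\<close>, outside it the convention of \<open>H_disc\<close> does.\<close>
      assume N: "?N f = 0"
      show "f = 0"
      proof
        fix z show "f z = 0 z"
        proof (cases "z \<in> unit_disc")
          case True
          then have "cmod z < 1" by simp
          obtain C where "C > 0" and C: "\<forall>f\<in>optimal_domain g (growth_space \<gamma>).
              \<forall>w\<in>cball 0 (cmod z). cmod (f w) \<le> C * ?N f"
            by (rule pointwise_bound[OF \<open>\<gamma> \<ge> 0\<close> nconst norm_ge_zero \<open>cmod z < 1\<close>])
          then have "cmod (f z) \<le> C * ?N f" using EX[OF f] by simp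
          then show ?thesis using N by simp
        next
          case False
          then show ?thesis using EH[OF f] by (simp add: H_disc_def)
        qed
      qed
    qed (simp add: volterra_0 growth_norm_0)
    show "?N (f + h) \<le> ?N f + ?N h" if "h \<in> ?E" for h
      using that f by (simp add: volterra_add EH EV growth_norm_add)
  qed
  interpret complex_normed_space fun_scale ?E ?N by (fact normed)
  have "mcomplete"
    unfolding mcomplete_def
  proof (intro allI impI)
    fix f assume "MCauchy f"
    then have fE: "\<And>n. f n \<in> ?E"
      unfolding MCauchy_def by blast
    have cauchy: "\<exists>N. \<forall>m\<ge>N. \<forall>n\<ge>N. ?N (f m - f n) < e" if "e > 0" for e
      using \<open>MCauchy f\<close> that fE by (simp add: MCauchy_def norm_dist_def)
    have fH: "\<And>n. f n \<in> H_disc" using EH fE by blast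
    have diffE: "f m - f n \<in> ?E" for m n
      by (intro subspace_diff subE fE)
    have ucauchy: "uniformly_Cauchy_on (cball 0 r) f" if "r < 1" for r
      unfolding uniformly_Cauchy_on_def
    proof (intro allI impI)
      fix e :: real assume "e > 0"
      \<comment> \<open>\<open>pointwise_bound\<close> expects a nonnegative radius, while
        \<open>r\<close> may be negative here.\<close>
      have r: "0 \<le> max 0 r" "max 0 r < 1" using \<open>r < 1\<close> by auto
      obtain C where C: "C > 0" "\<forall>f\<in>optimal_domain g (growth_space \<gamma>).
          \<forall>z\<in>cball 0 (max 0 r). cmod (f z) \<le> C * ?N f"
        by (rule pointwise_bound[OF \<open>\<gamma> \<ge> 0\<close> nconst r])
      obtain N where N: "\<And>m n. m \<ge> N \<Longrightarrow> n \<ge> N \<Longrightarrow> ?N (f m - f n) < e / C"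
        using cauchy[of "e / C"] \<open>e > 0\<close> C(1) by auto
      have "dist (f m z) (f n z) < e" if "z \<in> cball 0 r" "m \<ge> N" "n \<ge> N" for z m n
      proof -
        have "cmod ((f m - f n) z) \<le> C * ?N (f m - f n)"
          using that by (intro C(2)[rule_format] EX diffE) auto
        also have "\<dots> < e"
          using N[OF that(2,3)] C(1) by (simp add: field_simps)
        finally show ?thesis by (simp add: dist_norm)
      qed
      then show "\<exists>M. \<forall>x\<in>cball 0 r. \<forall>m\<ge>M. \<forall>n\<ge>M. dist (f m x) (f n x) < e"
        by blast
    qed
    obtain l where l: "l \<in> H_disc"
      and ul: "\<And>r. r < 1 \<Longrightarrow> uniform_limit (cball 0 r) f l sequentially"
      using H_disc_uniform_limit[OF fH ucauchy] by blast
    \<comment> \<open>In the Cauchy condition fix \<open>n\<close> and \<open>z\<close> and let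
      \<open>m\<close> tend to infinity. Pointwise convergence suffices, since \<open>N\<close> does
      not depend on \<open>z\<close>.\<close>
    have approx: "\<exists>N. \<forall>n\<ge>N. \<forall>z\<in>unit_disc.
        (1 - cmod z) powr \<gamma> * cmod (volterra g (f n) z - volterra g l z) \<le> e" if "e > 0" for e
    proof -
      obtain N where N: "\<And>m n. m \<ge> N \<Longrightarrow> n \<ge> N \<Longrightarrow> ?N (f m - f n) < e"
        using cauchy[OF \<open>e > 0\<close>] by blast
      have "(1 - cmod z) powr \<gamma> * cmod (volterra g (f n) z - volterra g l z) \<le> e"
        if n: "n \<ge> N" and z: "z \<in> unit_disc" for n z
      proof (rule tendsto_upperbound)
        show "(\<lambda>m. (1 - cmod z) powr \<gamma> * cmod (volterra g (f n) z - volterra g (f m) z))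
            \<longlonglongrightarrow> (1 - cmod z) powr \<gamma> * cmod (volterra g (f n) z - volterra g l z)"
          by (intro tendsto_intros volterra_tendsto fH l ul)
        have "(1 - cmod z) powr \<gamma> * cmod (volterra g (f n) z - volterra g (f m) z) \<le> e"
          if "m \<ge> N" for m
          using growth_norm_upper[OF EV[OF diffE] z, of n m] N[OF n that]
          by (simp add: volterra_diff fH)
        then show "\<forall>\<^sub>F m in sequentially.
            (1 - cmod z) powr \<gamma> * cmod (volterra g (f n) z - volterra g (f m) z) \<le> e"
          by (auto simp: eventually_sequentially)
      qed simp
      then show ?thesis by blast
    qed
    have "volterra g l \<in> X"
    proof (rule closed)
      show "volterra g l \<in> H_disc" by (intro volterra_in_H_disc l)
      show "\<exists>h\<in>X. \<forall>z\<in>unit_disc. (1 - cmod z) powr \<gamma> * cmod (h z - volterra g l z) \<le> e"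
        if "e > 0" for e
        using approx[OF that] fE unfolding optimal_domain_def by blast
    qed
    then have lE: "l \<in> ?E" using l by (simp add: optimal_domain_def)
    have "\<exists>N. \<forall>n\<ge>N. norm_dist (f n) l < e" if "e > 0" for e
    proof -
      \<comment> \<open>The supremum preserves only a non-strict bound, so \<open>e / 2\<close> is
        used to end strictly below \<open>e\<close>.\<close>
      obtain N where N: "\<And>n z. n \<ge> N \<Longrightarrow> z \<in> unit_disc \<Longrightarrow>
          (1 - cmod z) powr \<gamma> * cmod (volterra g (f n) z - volterra g l z) \<le> e / 2"
        using approx[OF half_gt_zero[OF \<open>e > 0\<close>]] by blast
      have "norm_dist (f n) l < e" if "n \<ge> N" for n
      proof -
        have "?N (f n - l) \<le> e / 2"
          using N[OF that] by (intro growth_norm_least) (simp add: volterra_diff fH l)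
        then show ?thesis using \<open>e > 0\<close> lE fE by (simp add: norm_dist_def)
      qed
      then show ?thesis by blast
    qed
    then have "limitin mtopology f l sequentially"
      unfolding limit_metric_sequentially using lE fE by blast
    then show "\<exists>l. limitin mtopology f l sequentially" by blast
  qed
  then show ?thesis
    by unfold_locales
qed

end

theorem proposition3p3:
  fixes g :: "complex \<Rightarrow> complex" and \<gamma> :: real
  assumes "g \<in> bloch_space"
    and "\<not> g constant_on unit_disc"
    and "\<gamma> > 0"
  shows "complex_banach_space fun_scale (optimal_domain g (growth_space \<gamma>))
           (\<lambda>f. growth_norm \<gamma> (volterra g f)) \<and>
         complex_banach_space fun_scale (optimal_domain g (little_growth_space \<gamma>))
           (\<lambda>f. growth_norm \<gamma> (volterra g f))"
proof
  have g: "g \<in> H_disc" and \<gamma>: "\<gamma> \<ge> 0"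
    using assms by (auto simp: bloch_space_def)
  note banach = optimal_domain_banach[OF g \<gamma> assms(2)]
  show "complex_banach_space fun_scale (optimal_domain g (growth_space \<gamma>))
      (\<lambda>f. growth_norm \<gamma> (volterra g f))"
  proof (rule banach[OF subspace_growth_space order_refl])
    fix u assume "u \<in> H_disc" and "\<And>e. e > 0 \<Longrightarrow> \<exists>h\<in>growth_space \<gamma>.
      \<forall>z\<in>unit_disc. (1 - cmod z) powr \<gamma> * cmod (h z - u z) \<le> e"
    then show "u \<in> growth_space \<gamma>"
      \<comment> \<open>A single approximant, taken at \<open>e = 1\<close>, is enough.\<close>
      using growth_space_closed zero_less_one by blast
  qed
  show "complex_banach_space fun_scale (optimal_domain g (little_growth_space \<gamma>))
      (\<lambda>f. growth_norm \<gamma> (volterra g f))"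
    by (intro banach subspace_little_growth_space little_growth_space_subset
        little_growth_space_closed \<gamma>)
qed

end
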